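(* Let $c\le -\tfrac32$. Then $$\tilde K^{-1}\big((-\infty,c]\big)\cup\{0\}=X_{\mathcal K_c^b}\cup X_{\mathcal K_c^u}\subset T^*\mathbb{C},$$ and $X_{\mathcal K_c^b}$ is a special concave toric domain.
   Context: Identify $T^*\mathbb{C}=\mathbb{C}\times\mathbb{C}$ with coordinates $(u,v)$, $u=u_1+iu_2$, $v=v_1+iv_2$. Define $\mu=(\mu_1,\mu_2):T^*\mathbb{C}\to[0,\infty)\times\mathbb{R}$ by $$\mu_1(u,v)=\tfrac12(|u|^2+|v|^2),\qquad \mu_2(u,v)=u_1v_2-u_2v_1 .$$ One has $|\mu_2|\le\mu_1$, so $\mu$ takes values in $Q_{1/2}:=\{(x,y)\in\mathbb{R}^2: x\ge 0,\ |y|\le x\}$. For $\Omega\subset Q_{1/2}$ put $X_\Omega:=\mu^{-1}(\Omega)\subset T^*\mathbb{C}$. The (regularized) Hamiltonian of the rotating Kepler problem is $$\tilde K:T^*\mathbb{C}\setminus\{0\}\to\mathbb{R},\qquad \tilde K=-\frac{1}{8\mu_1^2}+2\mu_2 .$$ For $c\le-\tfrac32$ set $\mathcal K_c:=\mu\big(\tilde K^{-1}((-\infty,c])\cup\{0\}\big)$, a closed subset of $Q_{1/2}$ (the origin is included by convention, since $\tilde K\to-\infty$ there). If $c<-\tfrac32$, then $\mathcal K_c$ has two connected components, one bounded and one unbounded, denoted $\mathcal K_c^b$ and $\mathcal K_c^u$ respectively. If $c=-\tfrac32$, the two pieces touch at the single point $(\tfrac12,-\tfrac12)$; then $\mathcal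 K_c^b$ and $\mathcal K_c^u$ denote the closures of the bounded and of the unbounded connected component of $\mathcal K_c\setminus\{(\tfrac12,-\tfrac12)\}$. Special concave toric domain: for closed $\Omega\subset Q_{1/2}$, $X_\Omega=\mu^{-1}(\Omega)$ is called a special concave toric domain if there exist $0<a<b<\infty$ and a convex function $g:[a,b]\to\mathbb{R}$ with $g(a)=a$ and $g(b)=-b$ such that $\Omega$ is the closed region in $Q_{1/2}$ bounded by the segments $\{(t,t):t\in[0,a]\}$ and $\{(t,-t):t\in[0,b]\}$ and the graph of $g$. *)

theory Defs
  imports "HOL-Analysis.Analysis"
begin

text \<open>The cotangent bundle of the complex plane is modelled by \<^typ>\<open>complex \<times> complex\<close>.\<close>

definition mu1 :: "complex \<times> complex \<Rightarrow> real" where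
  "mu1 = (\<lambda>(u, v). ((cmod u)\<^sup>2 + (cmod v)\<^sup>2) / 2)"

definition mu2 :: "complex \<times> complex \<Rightarrow> real" where
  "mu2 = (\<lambda>(u, v). Re u * Im v - Im u * Re v)"

definition mu :: "complex \<times> complex \<Rightarrow> real \<times> real" where
  "mu z = (mu1 z, mu2 z)"

definition Q_half :: "(real \<times> real) set" where
  "Q_half = {(x, y). 0 \<le> x \<and> \<bar>y\<bar> \<le> x}"

definition toric_domain :: "(real \<times> real) set \<Rightarrow> (complex \<times> complex) set" where
  "toric_domain \<Omega> = mu -` \<Omega>"

text \<open>The Hamiltonian is only meaningful away from the origin; its value at \<open>0\<close> is an
  artefact of division by zero, so \<open>0\<close> is excluded in \<open>sublevel\<close> below.\<close>

definition K_tilde :: "complex \<times> complex \<Rightarrow> real" where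
  "K_tilde z = - 1 / (8 * (mu1 z)\<^sup>2) + 2 * mu2 z"

definition sublevel :: "real \<Rightarrow> (complex \<times> complex) set" where
  "sublevel c = {z. z \<noteq> 0 \<and> K_tilde z \<le> c}"

definition K_region :: "real \<Rightarrow> (real \<times> real) set" where
  "K_region c = mu ` (sublevel c \<union> {0})"

text \<open>The next two definitions are intended for \<open>c \<le> - 3/2\<close>, so that the second branch is
  the critical value \<open>c = - 3/2\<close>.\<close>

definition K_bounded :: "real \<Rightarrow> (real \<times> real) set" where
  "K_bounded c =
     (if c < - 3/2
      then (THE C. C \<in> components (K_region c) \<and> bounded C)
      else closure (THE C. C \<in> components (K_region c - {(1/2, - 1/2)}) \<and> bounded C))"

definition K_unbounded :: "real \<Rightarrow> (real \<times> real) set" where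
  "K_unbounded c =
     (if c < - 3/2
      then (THE C. C \<in> components (K_region c) \<and> \<not> bounded C)
      else closure (THE C. C \<in> components (K_region c - {(1/2, - 1/2)}) \<and> \<not> bounded C))"

definition concave_boundary :: "real \<Rightarrow> real \<Rightarrow> (real \<Rightarrow> real) \<Rightarrow> (real \<times> real) set" where
  "concave_boundary a b g =
     (\<lambda>t. (t, t)) ` {0..a} \<union> (\<lambda>t. (t, - t)) ` {0..b} \<union> (\<lambda>t. (t, g t)) ` {a..b}"

text \<open>The closed region bounded by a closed curve is the curve together with the points it
  encloses, i.e. those in bounded components of its complement. Convexity does not give
  continuity of \<open>g\<close> at the endpoints of \<open>[a, b]\<close>; it is required separately, as otherwise the
  graph and the two segments do not form a closed curve.\<close>

definition special_concave_toric_domain :: "(complex \<times> complex) set \<Rightarrow> bool" where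
  "special_concave_toric_domain X \<longleftrightarrow>
     (\<exists>\<Omega>. closed \<Omega> \<and> \<Omega> \<subseteq> Q_half \<and> X = toric_domain \<Omega> \<and>
       (\<exists>a b g. 0 < a \<and> a < b \<and> convex_on {a..b} g \<and> continuous_on {a..b} g \<and>
          g a = a \<and> g b = - b \<and>
          \<Omega> = concave_boundary a b g \<union> inside (concave_boundary a b g)))"

end

theory Submission
  imports Defs
begin

text \<open>
The function \<^const>\<open>K_tilde\<close> depends only on \<^const>\<open>mu\<close>, and \<^const>\<open>mu\<close> maps onto \<^const>\<open>Q_half\<close>. So the
sublevel set is the full preimage of its moment image, and everything reduces to the planar set
of points of the quadrant lying on or below the curve \<open>y = f x\<close>, where
\<open>f x = c / 2 + 1 / (16 x\<^sup>2)\<close> (\<open>level_curve\<close>).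

The function \<open>f\<close> is convex and strictly decreasing on \<open>x > 0\<close>, so its graph crosses the upper edge
\<open>y = x\<close> of the quadrant once, at some \<open>a\<close>. A vertical slice of the region at \<open>x > 0\<close> is nonempty iff
the gap \<open>x + f x\<close> above the lower edge is nonnegative. Since \<open>1 + f' x = 1 - 1 / (8 x\<^sup>3)\<close>, this gap
decreases strictly up to \<open>x = 1/2\<close> and increases strictly afterwards, with minimum
\<open>(c + 3/2) / 2 \<le> 0\<close>. Hence the slices are nonempty exactly over \<open>[0, b]\<close> and \<open>[b', \<infinity>)\<close> with
\<open>a < b \<le> 1/2 \<le> b'\<close>. The vertical line \<open>x = 1/2\<close> misses the region if \<open>c < - 3/2\<close> and meets it only in
the point \<open>(1/2, - 1/2)\<close> if \<open>c = - 3/2\<close>. So it separates the two components, and in both cases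
the bounded and unbounded pieces are the parts of the region on the two sides of this line
(\<open>K_bounded_unbounded_eq\<close>).

The bounded piece is the set of points between two graphs over \<open>[0, b]\<close> with the same end points:
below, the segment of \<open>y = - x\<close>; above, the segment of \<open>y = x\<close> up to \<open>a\<close>, continued by the
graph of the convex function \<open>f\<close>. That such a set is the closed region
enclosed by the two graphs is \<open>region_between_graphs_eq_boundary_Un_inside\<close>. The key there is that
the complement is connected, because each of its points can escape vertically, up or down.
\<close>

section \<open>Planar regions bounded by graphs\<close>

lemma components_of_separated_union:
  fixes A B U V :: "'a::topological_space set"
  assumes "connected A" "connected B" "A \<noteq> {}" "B \<noteq> {}"
    and "open U" "open V" "U \<inter> V = {}" "A \<subseteq> U" "B \<subseteq> V"
  shows "components (A \<union> B) = {A, B}"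
proof -
  have max: "A' \<in> components (A' \<union> B')"
    if "connected A'" "A' \<noteq> {}" "open U'" "open V'" "U' \<inter> V' = {}" "A' \<subseteq> U'" "B' \<subseteq> V'"
    for A' B' U' V' :: "'a set"
    unfolding in_components_maximal
  proof (intro conjI allI impI)
    fix D assume D: "D \<noteq> {} \<and> A' \<subseteq> D \<and> D \<subseteq> A' \<union> B' \<and> connected D"
    have "U' \<inter> D = {} \<or> V' \<inter> D = {}"
      using connectedD[of D U' V'] D that by blast
    then show "D = A'" using D that by blast
  qed (use that in auto)
  have A: "A \<in> components (A \<union> B)"
    by (rule max[of A U V B]) (use assms in auto)
  have B: "B \<in> components (A \<union> B)"
    using max[of B V U A] assms by (simp add: Un_commute Int_commute)
  have "C = A \<or> C = B" if C: "C \<in> components (A \<union> B)" for C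
  proof -
    have "C \<noteq> {}" "C \<subseteq> A \<union> B"
      using C in_components_nonempty in_components_subset by blast+
    then have "A \<inter> C \<noteq> {} \<or> B \<inter> C \<noteq> {}" by blast
    then show ?thesis using components_eq[OF A C] components_eq[OF B C] by blast
  qed
  with A B show ?thesis by blast
qed

text \<open>Every point is joined by a vertical segment to the graph of \<open>l\<close>, which is connected.\<close>

lemma connected_region_over_graph:
  fixes l m :: "real \<Rightarrow> real"
  assumes "connected I" "continuous_on I l" "\<And>x. x \<in> I \<Longrightarrow> l x \<le> m x"
  shows "connected {(x, y). x \<in> I \<and> l x \<le> y \<and> y \<le> m x}"
proof (cases "I = {}")
  case False
  define G where "G = (\<lambda>x. (x, l x)) ` I"
  have G: "connected G" unfolding G_def
    by (intro connected_continuous_image continuous_intros assms)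
  have "{(x, y). x \<in> I \<and> l x \<le> y \<and> y \<le> m x} = (\<Union>x\<in>I. G \<union> {x} \<times> {l x..m x})"
    using assms(3) by (auto simp: G_def)
  moreover have "connected (\<Union>x\<in>I. G \<union> {x} \<times> {l x..m x})"
  proof (rule connected_Union)
    fix S assume "S \<in> (\<lambda>x. G \<union> {x} \<times> {l x..m x}) ` I"
    then obtain x where x: "x \<in> I" "S = G \<union> {x} \<times> {l x..m x}" by blast
    have "(x, l x) \<in> G \<inter> {x} \<times> {l x..m x}" using x assms(3) by (auto simp: G_def)
    then have "G \<inter> {x} \<times> {l x..m x} \<noteq> {}" by blast
    then show "connected S" unfolding x
      by (intro connected_Un G connected_Times) auto
  next
    show "\<Inter> ((\<lambda>x. G \<union> {x} \<times> {l x..m x}) ` I) \<noteq> {}"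
      using False by (auto simp: G_def)
  qed
  ultimately show ?thesis by simp
qed auto

text \<open>Every point can be moved vertically upwards into the half-plane above height \<open>H\<close>. Over points
outside \<open>S\<close> there is no constraint, so that this also describes the points from which one escapes
upwards from a bounded set lying over \<open>S\<close>.\<close>

lemma connected_above_graph:
  fixes m :: "real \<Rightarrow> real"
  assumes H: "\<And>x. x \<in> S \<Longrightarrow> m x < H"
  shows "connected {(x, y). x \<in> S \<longrightarrow> m x < y}"
proof -
  let ?P = "UNIV \<times> {H..} :: (real \<times> real) set"
  let ?U = "{(x, y). x \<in> S \<longrightarrow> m x < y}"
  have "?P \<subseteq> ?U" using H by fastforce
  then have "?U = (\<Union>z\<in>?U. ?P \<union> {fst z} \<times> {snd z..})"
    by fastforce
  moreover have "connected (\<Union>z\<in>?U. ?P \<union> {fst z} \<times> {snd z..})"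
  proof (rule connected_Union)
    fix T assume "T \<in> (\<lambda>z. ?P \<union> {fst z} \<times> {snd z..}) ` ?U"
    then obtain z :: "real \<times> real" where z: "T = ?P \<union> {fst z} \<times> {snd z..}" by blast
    have "(fst z, max H (snd z)) \<in> ?P \<inter> {fst z} \<times> {snd z..}" by simp
    then have "?P \<inter> {fst z} \<times> {snd z..} \<noteq> {}" by blast
    then show "connected T" unfolding z
      by (intro connected_Un connected_Times) auto
  next
    show "\<Inter> ((\<lambda>z. ?P \<union> {fst z} \<times> {snd z..}) ` ?U) \<noteq> {}"
    proof -
      have "(0, H) \<in> \<Inter> ((\<lambda>z. ?P \<union> {fst z} \<times> {snd z..}) ` ?U)" by simp
      then show ?thesis by blast
    qed
  qed
  ultimately show ?thesis by simp
qed

lemma connected_below_graph: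
  fixes l :: "real \<Rightarrow> real"
  assumes H: "\<And>x. x \<in> S \<Longrightarrow> H < l x"
  shows "connected {(x, y). x \<in> S \<longrightarrow> y < l x}"
proof -
  have "connected ((\<lambda>z::real\<times>real. (fst z, - snd z)) ` {(x, y). x \<in> S \<longrightarrow> - l x < y})"
    by (intro connected_continuous_image continuous_intros connected_above_graph[where H = "-H"])
      (use H in auto)
  also have "(\<lambda>z::real\<times>real. (fst z, - snd z)) ` {(x, y). x \<in> S \<longrightarrow> - l x < y}
      = {(x, y). x \<in> S \<longrightarrow> y < l x}"
  proof (intro equalityI subsetI)
    fix w assume w: "w \<in> {(x, y). x \<in> S \<longrightarrow> y < l x}"
    then have "w = (\<lambda>z. (fst z, - snd z)) (fst w, - snd w)" by simp
    then show "w \<in> (\<lambda>z. (fst z, - snd z)) ` {(x, y). x \<in> S \<longrightarrow> - l x < y}"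
      by (rule image_eqI) (use w in auto)
  qed auto
  finally show ?thesis .
qed

text \<open>The complement of the region is connected and unbounded, so it lies outside the boundary curve.
The open strip \<open>W\<close> strictly between the graphs and the complement of the region are disjoint
open sets covering the complement of the curve; hence a component meeting \<open>W\<close> stays in \<open>W\<close> and
is bounded.\<close>

lemma region_between_graphs_eq_boundary_Un_inside:
  fixes l m :: "real \<Rightarrow> real"
  assumes l: "continuous_on {p..q} l" and m: "continuous_on {p..q} m"
    and le: "\<And>x. x \<in> {p..q} \<Longrightarrow> l x \<le> m x"
    and ends: "l p = m p" "l q = m q"
  defines "B \<equiv> (\<lambda>x. (x, l x)) ` {p..q} \<union> (\<lambda>x. (x, m x)) ` {p..q}"
  shows "{(x, y). x \<in> {p..q} \<and> l x \<le> y \<and> y \<le> m x} = B \<union> inside B"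
proof -
  define R where "R = {(x, y). x \<in> {p..q} \<and> l x \<le> y \<and> y \<le> m x}"
  define W where "W = {(x, y). x \<in> {p<..<q} \<and> l x < y \<and> y < m x}"
  have BR: "B \<subseteq> R" using le by (auto simp: B_def R_def)
  have W_eq: "R - B = W"
  proof (rule set_eqI, clarify)
    fix x y
    have "x \<in> {p<..<q} \<longleftrightarrow> x \<in> {p..q} \<and> x \<noteq> p \<and> x \<noteq> q" by auto
    then show "(x, y) \<in> R - B \<longleftrightarrow> (x, y) \<in> W"
      using ends by (auto simp: R_def W_def B_def image_iff)
  qed
  have "bounded (l ` {p..q})"
    by (intro compact_imp_bounded compact_continuous_image l compact_Icc)
  then obtain L where L: "\<And>x. x \<in> {p..q} \<Longrightarrow> \<bar>l x\<bar> < L"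
    unfolding bounded_pos_less by (metis image_eqI real_norm_def)
  have "bounded (m ` {p..q})"
    by (intro compact_imp_bounded compact_continuous_image m compact_Icc)
  then obtain M where M: "\<And>x. x \<in> {p..q} \<Longrightarrow> \<bar>m x\<bar> < M"
    unfolding bounded_pos_less by (metis image_eqI real_norm_def)
  have R_sub: "R \<subseteq> {p..q} \<times> {-L..M}"
    using L M by (force simp: R_def abs_less_iff)
  have bR: "bounded R"
    by (rule bounded_subset[OF _ R_sub]) (simp add: bounded_Times)
  \<comment> \<open>Any point outside the region can move up above height M or down below -L;
      the two families of outer points share the points to the left of the region.\<close>
  have "connected ({(x, y). x \<in> {p..q} \<longrightarrow> m x < y} \<union> {(x, y). x \<in> {p..q} \<longrightarrow> y < l x})"
  proof (rule connected_Un)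
    show "connected {(x, y). x \<in> {p..q} \<longrightarrow> m x < y}"
      by (rule connected_above_graph[where H = M]) (use M in \<open>auto simp: abs_less_iff\<close>)
    show "connected {(x, y). x \<in> {p..q} \<longrightarrow> y < l x}"
      by (rule connected_below_graph[where H = "-L"]) (use L in \<open>force simp: abs_less_iff\<close>)
    have "(p - 1, 0) \<in> {(x, y). x \<in> {p..q} \<longrightarrow> m x < y} \<inter> {(x, y). x \<in> {p..q} \<longrightarrow> y < l x}"
      by simp
    then show "{(x, y). x \<in> {p..q} \<longrightarrow> m x < y} \<inter> {(x, y). x \<in> {p..q} \<longrightarrow> y < l x} \<noteq> {}"
      by blast
  qed
  also have "{(x, y). x \<in> {p..q} \<longrightarrow> m x < y} \<union> {(x, y). x \<in> {p..q} \<longrightarrow> y < l x} = - R"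
    by (auto simp: R_def)
  finally have conn: "connected (- R)" .
  have unb: "\<not> bounded (- R)"
    using bR cobounded_imp_unbounded by fastforce
  have openW: "open W"
  proof -
    have o: "open ({p<..<q} \<times> (UNIV :: real set))" by (intro open_Times) auto
    have c: "continuous_on ({p<..<q} \<times> (UNIV :: real set)) (\<lambda>z. snd z - l (fst z))"
        "continuous_on ({p<..<q} \<times> (UNIV :: real set)) (\<lambda>z. m (fst z) - snd z)"
      by (auto intro!: continuous_intros continuous_on_compose2[OF l] continuous_on_compose2[OF m])
    have "W = ((\<lambda>z. snd z - l (fst z)) -` {0<..} \<inter> {p<..<q} \<times> UNIV)
          \<inter> ((\<lambda>z. m (fst z) - snd z) -` {0<..} \<inter> {p<..<q} \<times> UNIV)"
      by (auto simp: W_def)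
    then show ?thesis
      using c[THEN continuous_on_open_vimage[OF o, THEN iffD1], THEN spec, of "{0<..}"]
      by auto
  qed
  have "closed R"
  proof -
    have cl: "closed ({p..q} \<times> (UNIV :: real set))" by (intro closed_Times) auto
    have c: "continuous_on ({p..q} \<times> (UNIV :: real set)) (\<lambda>z. snd z - l (fst z))"
        "continuous_on ({p..q} \<times> (UNIV :: real set)) (\<lambda>z. m (fst z) - snd z)"
      by (auto intro!: continuous_intros continuous_on_compose2[OF l] continuous_on_compose2[OF m])
    have "R = ((\<lambda>z. snd z - l (fst z)) -` {0..} \<inter> {p..q} \<times> UNIV)
          \<inter> ((\<lambda>z. m (fst z) - snd z) -` {0..} \<inter> {p..q} \<times> UNIV)"
      by (auto simp: R_def)
    then show ?thesis
      using c[THEN continuous_on_closed_vimage[OF cl, THEN iffD1], THEN spec, of "{0..}"]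
      by auto
  qed
  then have openR: "open (- R)" by (rule open_Compl)
  have "inside B \<subseteq> W"
    by (rule inside_subset[OF conn unb]) (use W_eq BR in blast)
  moreover have "W \<subseteq> inside B"
  proof
    fix z assume z: "z \<in> W"
    let ?C = "connected_component_set (- B) z"
    have "?C \<subseteq> - B" by (rule connected_component_subset)
    then have sub: "?C \<subseteq> W \<union> - R" using W_eq by blast
    have "z \<in> ?C" using z W_eq by auto
    moreover have "W \<inter> ?C = {} \<or> - R \<inter> ?C = {}"
      using connectedD[OF connected_connected_component openW openR, of "- B" z] sub W_eq by blast
    ultimately have "?C \<subseteq> R" using z sub W_eq by blast
    then have "bounded ?C" using bR bounded_subset by blast
    then show "z \<in> inside B" using z W_eq by (auto simp: inside_def)
  qed
  ultimately show ?thesis using W_eq BR unfolding R_def[symmetric] by blast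
qed

section \<open>The moment image of a sublevel set\<close>

lemma mu1_nonneg: "0 \<le> mu1 z"
  by (cases z) (simp add: mu1_def)

lemma abs_mu2_le_mu1: "\<bar>mu2 z\<bar> \<le> mu1 z"
proof (cases z)
  case (Pair u v)
  have "0 \<le> (Re u - Im v)\<^sup>2 + (Im u + Re v)\<^sup>2" "0 \<le> (Re u + Im v)\<^sup>2 + (Im u - Re v)\<^sup>2"
    by simp_all
  then show ?thesis
    unfolding Pair mu1_def mu2_def prod.case cmod_power2
    by (intro abs_leI) (simp_all add: power2_eq_square field_simps)
qed

lemma mu1_eq_0_iff: "mu1 z = 0 \<longleftrightarrow> z = 0"
  by (cases z) (simp add: mu1_def add_nonneg_eq_0_iff zero_prod_def)

text \<open>
For \<open>u = r\<close> real and \<open>v = i s\<close> imaginary, \<open>mu (u, v) = ((r\<^sup>2 + s\<^sup>2) / 2, r s)\<close>. The witness solves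
\<open>(r + s)\<^sup>2 = 2 (x + y)\<close> and \<open>(r - s)\<^sup>2 = 2 (x - y)\<close>.
\<close>

lemma Q_half_subset_range_mu:
  assumes "\<bar>y\<bar> \<le> x"
  obtains z where "mu z = (x, y)"
proof -
  define r where "r = (sqrt (x + y) + sqrt (x - y)) / sqrt 2"
  define s where "s = (sqrt (x + y) - sqrt (x - y)) / sqrt 2"
  have nn: "0 \<le> x + y" "0 \<le> x - y" using assms by auto
  have "(r\<^sup>2 + s\<^sup>2) / 2 = x" "r * s = y"
    using nn by (auto simp: r_def s_def power_divide power2_sum power2_diff field_simps)
  then have "mu (Complex r 0, Complex 0 s) = (x, y)"
    by (simp add: mu_def mu1_def mu2_def cmod_power2)
  then show ?thesis by (rule that)
qed

text \<open>Multiplying the inequality by \<open>8 (mu1 z)\<^sup>2\<close> removes the pole. The polynomial form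
holds at the origin, in accordance with the convention that the origin is included, and it makes
the moment image visibly closed.\<close>

lemma mem_sublevel_iff:
  "z \<in> sublevel c \<union> {0} \<longleftrightarrow> 16 * (mu1 z)\<^sup>2 * mu2 z \<le> 8 * c * (mu1 z)\<^sup>2 + 1"
proof (cases "z = 0")
  case True
  then have "mu1 z = 0" by (simp add: mu1_eq_0_iff)
  then show ?thesis using True by simp
next
  case False
  then have "0 < mu1 z" using mu1_eq_0_iff mu1_nonneg by (metis less_eq_real_def)
  then have "0 < (mu1 z)\<^sup>2" by simp
  then show ?thesis using False
    by (simp add: sublevel_def K_tilde_def field_simps)
qed

lemma K_region_eq: "K_region c = {(x, y). \<bar>y\<bar> \<le> x \<and> 16 * x\<^sup>2 * y \<le> 8 * c * x\<^sup>2 + 1}"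
proof (intro equalityI subsetI)
  fix w assume "w \<in> K_region c"
  then obtain z where "w = mu z" "z \<in> sublevel c \<union> {0}"
    unfolding K_region_def by (rule imageE)
  then show "w \<in> {(x, y). \<bar>y\<bar> \<le> x \<and> 16 * x\<^sup>2 * y \<le> 8 * c * x\<^sup>2 + 1}"
    unfolding mem_sublevel_iff by (simp add: mu_def abs_mu2_le_mu1)
next
  fix w :: "real \<times> real"
  assume w: "w \<in> {(x, y). \<bar>y\<bar> \<le> x \<and> 16 * x\<^sup>2 * y \<le> 8 * c * x\<^sup>2 + 1}"
  obtain x y where xy: "w = (x, y)" by fastforce
  obtain z where z: "mu z = (x, y)" using w xy by (auto elim: Q_half_subset_range_mu)
  then have "z \<in> sublevel c \<union> {0}" using w xy unfolding mem_sublevel_iff by (simp add: mu_def)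
  then show "w \<in> K_region c" using z xy unfolding K_region_def by (metis image_eqI)
qed

lemma toric_domain_K_region: "toric_domain (K_region c) = sublevel c \<union> {0}"
  by (rule set_eqI, unfold mem_sublevel_iff)
    (simp add: toric_domain_def K_region_eq mu_def abs_mu2_le_mu1)

lemma closed_K_region: "closed (K_region c)"
  unfolding K_region_eq case_prod_unfold
  by (intro closed_Collect_conj closed_Collect_le continuous_intros)

section \<open>The level curve and the two edges of the quadrant\<close>

text \<open>The level set \<open>- 1 / (8 x\<^sup>2) + 2 y = c\<close> of the Hamiltonian in the coordinates
\<open>(x, y) = (mu1, mu2)\<close>, solved for \<open>y\<close>.\<close>

definition level_curve :: "real \<Rightarrow> real \<Rightarrow> real" where
  "level_curve c x = c / 2 + 1 / (16 * x\<^sup>2)"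

lemma mem_K_region_iff:
  assumes "0 < x"
  shows "(x, y) \<in> K_region c \<longleftrightarrow> - x \<le> y \<and> y \<le> x \<and> y \<le> level_curve c x"
  using assms by (auto simp: K_region_eq level_curve_def field_simps)

lemma continuous_on_level_curve:
  "(\<And>x. x \<in> S \<Longrightarrow> 0 < x) \<Longrightarrow> continuous_on S (level_curve c)"
  unfolding level_curve_def by (intro continuous_intros) auto

lemma level_curve_strict_antimono:
  assumes "0 < x" "x < y"
  shows "level_curve c y < level_curve c x"
  using assms by (auto simp: level_curve_def intro!: divide_strict_left_mono power_strict_mono)

lemma convex_on_level_curve: "convex_on {0<..} (level_curve c)"
proof (rule f''_ge0_imp_convex)
  fix x :: real assume "x \<in> {0<..}"
  then have x: "0 < x" by simp
  show "(level_curve c has_real_derivative - 1 / (8 * x ^ 3)) (at x)"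
    unfolding level_curve_def[abs_def] using x
    by (auto intro!: derivative_eq_intros simp: field_simps eval_nat_numeral)
  show "((\<lambda>x. - 1 / (8 * x ^ 3)) has_real_derivative 3 / (8 * x ^ 4)) (at x)"
    using x by (auto intro!: derivative_eq_intros simp: field_simps eval_nat_numeral)
  show "0 \<le> 3 / (8 * x ^ 4)" using x by simp
qed simp

text \<open>The difference of the gaps \<open>x + f x\<close> above the lower edge, factored so that its sign can be read
off: the sum of the two fractions exceeds \<open>16\<close> for distinct points of \<open>(0, 1/2]\<close> and is less
than \<open>16\<close> for distinct points of \<open>[1/2, \<infinity>)\<close>, since \<open>1 / (1/2)\<^sup>3 = 8\<close>.\<close>

lemma lower_gap_diff:
  assumes "0 < x" "0 < y"
  shows "(x + level_curve c x) - (y + level_curve c y)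
    = (y - x) * ((1 / (x * y\<^sup>2) + 1 / (x\<^sup>2 * y)) / 16 - 1)"
  using assms by (simp add: level_curve_def field_simps power2_eq_square)

lemma lower_gap_decreasing:
  assumes "0 < x" "x < y" "y \<le> 1/2"
  shows "y + level_curve c y < x + level_curve c x"
proof -
  have "x * y\<^sup>2 < (1/2) * (1/2)\<^sup>2"
    by (intro mult_strict_mono' power_mono mult_less_le_imp_less) (use assms in auto)
  moreover have "x\<^sup>2 * y < (1/2)\<^sup>2 * (1/2)"
    by (rule mult_less_le_imp_less) (use assms in \<open>auto intro!: power_strict_mono\<close>)
  ultimately have "8 < 1 / (x * y\<^sup>2)" "8 < 1 / (x\<^sup>2 * y)"
    using assms by (auto simp: field_simps power2_eq_square)
  then have "0 < (y - x) * ((1 / (x * y\<^sup>2) + 1 / (x\<^sup>2 * y)) / 16 - 1)"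
    using assms by (intro mult_pos_pos) auto
  then show ?thesis using lower_gap_diff[of x y c] assms by simp
qed

lemma lower_gap_increasing:
  assumes "1/2 \<le> x" "x < y"
  shows "x + level_curve c x < y + level_curve c y"
proof -
  have "(1/2) * (1/2)\<^sup>2 < x * y\<^sup>2"
    by (rule mult_le_less_imp_less) (use assms in \<open>auto intro!: power_strict_mono\<close>)
  moreover have "(1/2)\<^sup>2 * (1/2) < x\<^sup>2 * y"
    by (rule mult_le_less_imp_less) (use assms in \<open>auto intro!: power_mono\<close>)
  ultimately have "1 / (x * y\<^sup>2) < 8" "1 / (x\<^sup>2 * y) < 8"
    using assms by (auto simp: field_simps power2_eq_square)
  then have "(y - x) * ((1 / (x * y\<^sup>2) + 1 / (x\<^sup>2 * y)) / 16 - 1) < 0"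
    using assms by (intro mult_pos_neg) auto
  then show ?thesis using lower_gap_diff[of x y c] assms by simp
qed

lemma level_curve_ge_lower_edge:
  assumes "0 < x" "x \<le> b" "b \<le> 1/2" "level_curve c b = - b"
  shows "- x \<le> level_curve c x"
  using lower_gap_decreasing[of x b c] assms by (cases "x = b") auto

lemma lower_gap_at_half: "1/2 + level_curve c (1/2) = (c + 3/2) / 2"
  by (simp add: level_curve_def power2_eq_square)

lemma level_curve_crossings:
  assumes "c \<le> - 3/2"
  obtains a b b' where
    "0 < a" "a < b" "b \<le> 1/2" "1/2 \<le> b'"
    "level_curve c a = a" "level_curve c b = - b" "level_curve c b' = - b'"
proof -
  have cont: "continuous_on {x..y} (level_curve c)" if "0 < x" for x y
    using that by (intro continuous_on_level_curve) auto
  \<comment> \<open>A point so close to 0 that the pole of the curve dominates.\<close>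
  define e where "e = 1 / (8 * (1 - c))"
  have e: "0 < e" "e \<le> 1/2" using assms by (auto simp: e_def field_simps)
  have half: "level_curve c (1/2) \<le> - 1/2" using lower_gap_at_half[of c] assms by simp
  have "1 / (16 * e\<^sup>2) = 4 * (1 - c)\<^sup>2"
    using assms by (simp add: e_def power2_eq_square field_simps)
  moreover have "1 * (1 - c) \<le> (1 - c)\<^sup>2"
    unfolding power2_eq_square using assms by (intro mult_right_mono) auto
  ultimately have "level_curve c e \<ge> e"
    using e assms by (simp add: level_curve_def)
  then have "\<exists>a. e \<le> a \<and> a \<le> 1/2 \<and> level_curve c a - a = 0"
    by (intro IVT2') (use e half cont in \<open>auto intro!: continuous_intros\<close>)
  then obtain a where a: "e \<le> a" "a \<le> 1/2" "level_curve c a = a" by auto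
  have "0 < a" using a e by linarith
  have "\<exists>b. a \<le> b \<and> b \<le> 1/2 \<and> b + level_curve c b = 0"
    by (intro IVT2') (use a \<open>0 < a\<close> half cont in \<open>auto intro!: continuous_intros\<close>)
  then obtain b where b: "a \<le> b" "b \<le> 1/2" "level_curve c b = - b" by (auto simp: add_eq_0_iff)
  have "a \<noteq> b" using a b \<open>0 < a\<close> by auto
  \<comment> \<open>At - c/2 the gap is exactly the positive term 1 / (16 x^2).\<close>
  have "\<exists>b'. 1/2 \<le> b' \<and> b' \<le> - c/2 \<and> b' + level_curve c b' = 0"
  proof (intro IVT')
    show "0 \<le> - c/2 + level_curve c (- c/2)" by (simp add: level_curve_def)
  qed (use half assms cont in \<open>auto intro!: continuous_intros\<close>)
  then obtain b' where "1/2 \<le> b'" "level_curve c b' = - b'" by (auto simp: add_eq_0_iff)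
  then show ?thesis using that[of a b b'] a b \<open>0 < a\<close> \<open>a \<noteq> b\<close> by auto
qed

section \<open>The two pieces of the moment image\<close>

definition left_piece :: "real \<Rightarrow> (real \<times> real) set" where
  "left_piece c = K_region c \<inter> {..1/2} \<times> UNIV"

definition right_piece :: "real \<Rightarrow> (real \<times> real) set" where
  "right_piece c = K_region c \<inter> {1/2..} \<times> UNIV"

lemma K_region_eq_pieces: "K_region c = left_piece c \<union> right_piece c"
  by (auto simp: left_piece_def right_piece_def)

lemma closed_left_piece: "closed (left_piece c)"
  unfolding left_piece_def by (intro closed_Int closed_K_region closed_Times) auto

lemma closed_right_piece: "closed (right_piece c)"
  unfolding right_piece_def by (intro closed_Int closed_K_region closed_Times) auto

text \<open>Up to \<open>a\<close> the upper edge of the quadrant is the binding constraint, between \<open>a\<close> and \<open>b\<close> the level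
curve is, and beyond \<open>b\<close> the level curve has dropped below the lower edge.\<close>

lemma left_piece_eq:
  assumes a: "0 < a" "a < b" "level_curve c a = a" and b: "b \<le> 1/2" "level_curve c b = - b"
  shows "left_piece c
    = {(x, y). x \<in> {0..b} \<and> - x \<le> y \<and> y \<le> (if x \<le> a then x else level_curve c x)}"
proof (rule set_eqI, clarify)
  fix x y :: real
  consider "x < 0" | "x = 0" | "0 < x" "x < a" | "x = a" | "a < x" "x < b" | "x = b"
    | "b < x" "x \<le> 1/2" | "1/2 < x" by linarith
  then show "(x, y) \<in> left_piece c \<longleftrightarrow>
    (x, y) \<in> {(x, y). x \<in> {0..b} \<and> - x \<le> y \<and> y \<le> (if x \<le> a then x else level_curve c x)}"
  proof cases
    case 3
    then show ?thesis
      using level_curve_strict_antimono[of x a c] a b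
      by (auto simp: left_piece_def mem_K_region_iff)
  next
    case 5
    then show ?thesis
      using level_curve_strict_antimono[of a x c] a b
      by (auto simp: left_piece_def mem_K_region_iff)
  next
    case 7
    then show ?thesis
      using lower_gap_decreasing[of b x c] a b
      by (auto simp: left_piece_def mem_K_region_iff)
  qed (use a b in \<open>auto simp: left_piece_def mem_K_region_iff, auto simp: K_region_eq\<close>)
qed

text \<open>To the right of \<open>1/2\<close> the level curve is below the upper edge, so only the lower edge matters.\<close>

lemma right_piece_eq:
  assumes c: "c \<le> - 3/2" and b: "1/2 \<le> b" "level_curve c b = - b"
  shows "right_piece c = {(x, y). x \<in> {b..} \<and> - x \<le> y \<and> y \<le> level_curve c x}"
proof (rule set_eqI, clarify)
  fix x y :: real
  have half: "level_curve c (1/2) \<le> - 1/2" using lower_gap_at_half[of c] c by simp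
  consider "x < 1/2" | "1/2 \<le> x" "x < b" | "b \<le> x" by linarith
  then show "(x, y) \<in> right_piece c \<longleftrightarrow>
      (x, y) \<in> {(x, y). x \<in> {b..} \<and> - x \<le> y \<and> y \<le> level_curve c x}"
  proof cases
    case 2
    then show ?thesis
      using lower_gap_increasing[of x b c] b
      by (auto simp: right_piece_def mem_K_region_iff)
  next
    case 3
    then have "level_curve c x \<le> x"
      using level_curve_strict_antimono[of "1/2" x c] half b by (cases "x = 1/2") force+
    then show ?thesis using 3 b by (auto simp: right_piece_def mem_K_region_iff)
  qed (use b in \<open>auto simp: right_piece_def\<close>)
qed

lemma K_region_at_half:
  assumes "c \<le> - 3/2"
  shows "(1/2, y) \<in> K_region c \<longleftrightarrow> c = - 3/2 \<and> y = - 1/2"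
  using lower_gap_at_half[of c] assms by (auto simp: mem_K_region_iff)

text \<open>The line \<open>x = 1/2\<close> is left out on both sides, which treats the region for \<open>c < - 3/2\<close>
and the punctured region for \<open>c = - 3/2\<close> at once.\<close>

lemma components_open_pieces:
  assumes c: "c \<le> - 3/2"
  defines "A \<equiv> K_region c \<inter> {..<1/2} \<times> UNIV" and "B \<equiv> K_region c \<inter> {1/2<..} \<times> UNIV"
  shows "components (A \<union> B) = {A, B}" and "bounded A" and "\<not> bounded B"
proof -
  obtain a b b' where ab: "0 < a" "a < b" "level_curve c a = a" "b \<le> 1/2" "level_curve c b = - b"
    and b': "1/2 \<le> b'" "level_curve c b' = - b'"
    using level_curve_crossings[OF c] by metis
  let ?m = "\<lambda>x. if x \<le> a then x else level_curve c x"
  have "A = left_piece c \<inter> {..<1/2} \<times> UNIV" by (auto simp: A_def left_piece_def)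
  then have A: "A = {(x, y). x \<in> {0..b} \<inter> {..<1/2} \<and> - x \<le> y \<and> y \<le> ?m x}"
    unfolding left_piece_eq[OF ab] by auto
  have "B = right_piece c \<inter> {1/2<..} \<times> UNIV" by (auto simp: B_def right_piece_def)
  then have B: "B = {(x, y). x \<in> {b'..} \<inter> {1/2<..} \<and> - x \<le> y \<and> y \<le> level_curve c x}"
    unfolding right_piece_eq[OF c b'] by auto
  have lower: "- x \<le> level_curve c x" if "a < x" "x \<le> b" for x
    using level_curve_ge_lower_edge[of x b c] that ab by simp
  have upper: "- x \<le> level_curve c x" if "b' \<le> x" for x
    using lower_gap_increasing[of b' x c] that b' by (cases "x = b'") auto
  have "connected A" unfolding A
    by (rule connected_region_over_graph)
      (use lower in \<open>auto intro!: continuous_intros convex_connected convex_Int\<close>)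
  moreover have "connected B" unfolding B
    by (rule connected_region_over_graph)
      (use upper in \<open>auto intro!: continuous_intros convex_connected convex_Int\<close>)
  moreover have "(0, 0) \<in> A" using ab by (simp add: A)
  moreover have inB: "(x, - x) \<in> B" if "b' < x" for x using that b' upper[of x] by (simp add: B)
  then have "B \<noteq> {}" using gt_ex by blast
  moreover have "open ({..<1/2} \<times> UNIV :: (real \<times> real) set)" "open ({1/2<..} \<times> UNIV :: (real \<times> real) set)"
    by (auto intro!: open_Times)
  ultimately show "components (A \<union> B) = {A, B}"
    by (intro components_of_separated_union[of A B "{..<1/2} \<times> UNIV" "{1/2<..} \<times> UNIV"])
      (auto simp: A_def B_def)
  have "A \<subseteq> {0..1/2} \<times> {-1/2..1/2}" by (auto simp: A_def K_region_eq)
  then show "bounded A" using bounded_subset bounded_Times bounded_closed_interval by metis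
  show "\<not> bounded B"
  proof
    assume "bounded B"
    then have "bdd_above (fst ` B)" by (intro bounded_imp_bdd_above bounded_fst)
    then obtain M where M: "\<And>z. z \<in> B \<Longrightarrow> fst z \<le> M" by (auto simp: bdd_above_def)
    have "b' < max b' M + 1" by linarith
    from M[OF inB[OF this]] show False by simp
  qed
qed

lemma the_bounded_and_unbounded:
  assumes "components S = {A, B}" "bounded A" "\<not> bounded B"
  shows "(THE C. C \<in> components S \<and> bounded C) = A"
    and "(THE C. C \<in> components S \<and> \<not> bounded C) = B"
  using assms by (auto intro!: the_equality)

text \<open>For \<open>c < - 3/2\<close> nothing lies over \<open>x = 1/2\<close>. For \<open>c = - 3/2\<close> the closures restore the point \<open>(1/2, - 1/2)\<close> to
both pieces: it is approached from either side along the lower edge \<open>y = - x\<close>, which lies entirely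
in the region, and nothing else is added because both pieces are closed.\<close>

lemma K_bounded_unbounded_eq:
  assumes c: "c \<le> - 3/2"
  shows "K_bounded c = left_piece c" and "K_unbounded c = right_piece c"
proof -
  let ?A = "K_region c \<inter> {..<1/2} \<times> UNIV" and ?B = "K_region c \<inter> {1/2<..} \<times> UNIV"
  note half = K_region_at_half[OF c]
  note comps = the_bounded_and_unbounded[OF components_open_pieces[OF c]]
  have "K_bounded c = left_piece c \<and> K_unbounded c = right_piece c"
  proof (cases "c < - 3/2")
    case True
    have "fst w \<noteq> 1/2" if "w \<in> K_region c" for w
      using half[of "snd w"] True that by (metis less_irrefl prod.collapse)
    then have eqs: "left_piece c = ?A" "right_piece c = ?B"
      unfolding left_piece_def right_piece_def by (fastforce simp: less_le)+
    then show ?thesis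
      using comps True unfolding K_bounded_def K_unbounded_def K_region_eq_pieces by simp
  next
    case False
    then have c': "c = - 3/2" using c by simp
    have touching_point: "w = (1/2, - 1/2)" if "w \<in> K_region c" "fst w = 1/2" for w
      using half[of "snd w"] that by (metis prod.collapse)
    have punctured: "K_region c - {(1/2, - 1/2)} = ?A \<union> ?B"
    proof (intro equalityI subsetI)
      fix w assume w: "w \<in> K_region c - {(1/2, - 1/2)}"
      then have "fst w \<noteq> 1/2" using touching_point by blast
      then show "w \<in> ?A \<union> ?B" using w by (auto simp: mem_Times_iff)
    qed auto
    have edge: "(t, - t) \<in> K_region c" if "0 \<le> t" for t
    proof (cases "t = 0")
      case False
      have "0 \<le> t + level_curve c t"
      proof (cases t "1/2 :: real" rule: linorder_cases)
        case equal
        show ?thesis unfolding equal lower_gap_at_half using c' by simp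
      qed (use lower_gap_at_half[of c] lower_gap_decreasing[of t "1/2" c]
          lower_gap_increasing[of "1/2" t c] that False c' in auto)
      then show ?thesis using that False by (simp add: mem_K_region_iff)
    qed (simp add: K_region_eq)
    have clo: "(\<lambda>t. (t, - t)) ` closure I \<subseteq> closure ((\<lambda>t. (t, - t)) ` I)" for I :: "real set"
      by (intro image_closure_subset continuous_intros closed_closure closure_subset)
    have "(1/2, - 1/2) \<in> closure ((\<lambda>t. (t, - t)) ` {0..<1/2::real})"
      using clo[of "{0..<1/2}"] by force
    moreover have "(\<lambda>t. (t, - t)) ` {0..<1/2::real} \<subseteq> ?A" using edge by auto
    ultimately have pA: "(1/2, - 1/2) \<in> closure ?A" using closure_mono by blast
    have "(1/2, - 1/2) \<in> closure ((\<lambda>t. (t, - t)) ` {1/2::real<..})"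
      using clo[of "{1/2<..}"] by force
    moreover have "(\<lambda>t. (t, - t)) ` {1/2::real<..} \<subseteq> ?B" using edge by auto
    ultimately have pB: "(1/2, - 1/2) \<in> closure ?B" using closure_mono by blast
    have "left_piece c \<subseteq> insert (1/2, - 1/2) ?A" "right_piece c \<subseteq> insert (1/2, - 1/2) ?B"
      using touching_point by (force simp: left_piece_def right_piece_def mem_Times_iff less_le)+
    moreover have "?A \<subseteq> left_piece c" "?B \<subseteq> right_piece c"
      by (auto simp: left_piece_def right_piece_def)
    moreover have "closure X = P"
      if "X \<subseteq> P" "P \<subseteq> insert p X" "closed P" "p \<in> closure X" for X P and p :: "real \<times> real"
      using that closure_minimal[of X P] closure_subset[of X] by blast
    ultimately have "closure ?A = left_piece c" "closure ?B = right_piece c"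
      using pA pB closed_left_piece closed_right_piece by metis+
    then show ?thesis
      using comps False unfolding K_bounded_def K_unbounded_def punctured by simp
  qed
  then show "K_bounded c = left_piece c" "K_unbounded c = right_piece c" by auto
qed

lemma special_concave_left_piece:
  assumes c: "c \<le> - 3/2"
  shows "special_concave_toric_domain (toric_domain (left_piece c))"
proof -
  obtain a b where ab: "0 < a" "a < b" "level_curve c a = a" "b \<le> 1/2" "level_curve c b = - b"
    using level_curve_crossings[OF c] by metis
  let ?m = "\<lambda>x. if x \<le> a then x else level_curve c x"
  have lower: "- x \<le> level_curve c x" if "a < x" "x \<le> b" for x
    using level_curve_ge_lower_edge[of x b c] that ab by simp
  have cont: "continuous_on {a..b} (level_curve c)"
    using ab by (intro continuous_on_level_curve) auto
  have conv: "convex_on {a..b} (level_curve c)"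
    using ab by (intro convex_on_subset[OF convex_on_level_curve]) auto
  have "continuous_on ({0..a} \<union> {a..b}) ?m"
    by (rule continuous_on_cases) (use ab cont in auto)
  moreover have "{0..a} \<union> {a..b} = {0..b}" using ab by auto
  ultimately have m: "continuous_on {0..b} ?m" by simp
  have image_m: "(\<lambda>x. (x, ?m x)) ` {0..b} = (\<lambda>x. (x, x)) ` {0..a} \<union> (\<lambda>x. (x, level_curve c x)) ` {a..b}"
    using ab by (force simp: image_iff)
  have "left_piece c = (\<lambda>x. (x, - x)) ` {0..b} \<union> (\<lambda>x. (x, ?m x)) ` {0..b}
      \<union> inside ((\<lambda>x. (x, - x)) ` {0..b} \<union> (\<lambda>x. (x, ?m x)) ` {0..b})"
    unfolding left_piece_eq[OF ab]
    by (rule region_between_graphs_eq_boundary_Un_inside)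
      (use ab m lower in \<open>auto intro!: continuous_intros\<close>)
  also have "(\<lambda>x. (x, - x)) ` {0..b} \<union> (\<lambda>x. (x, ?m x)) ` {0..b} = concave_boundary a b (level_curve c)"
    unfolding image_m concave_boundary_def by blast
  finally have "left_piece c
      = concave_boundary a b (level_curve c) \<union> inside (concave_boundary a b (level_curve c))" .
  moreover have "left_piece c \<subseteq> Q_half"
    by (auto simp: left_piece_def K_region_eq Q_half_def)
  ultimately show ?thesis
    unfolding special_concave_toric_domain_def
    using closed_left_piece ab cont conv by metis
qed

theorem theorem5p7:
  fixes c :: real
  assumes "c \<le> - 3/2"
  shows "sublevel c \<union> {0} = toric_domain (K_bounded c) \<union> toric_domain (K_unbounded c)
    \<and> special_concave_toric_domain (toric_domain (K_bounded c))"
proof -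
  have "sublevel c \<union> {0} = toric_domain (left_piece c \<union> right_piece c)"
    by (simp add: toric_domain_K_region K_region_eq_pieces[symmetric])
  then show ?thesis
    using K_bounded_unbounded_eq[OF assms] special_concave_left_piece[OF assms]
    by (simp add: toric_domain_def vimage_Un)
qed

end
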